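(* For each integer $n>1$ there exist a polynomial $p\in\mathbb{C}[z]$ of degree $n$, a polynomial $q\in\mathbb{C}[z]$ of degree $1$, and a complex number $w$ such that the equation $p(z)\,\overline{q(z)}=w$ has exactly $3n-1$ solutions $z\in\mathbb{C}$.
   Context: Solutions are counted as distinct points $z\in\mathbb{C}$ (no multiplicity). The bar denotes complex conjugation. *)

theory Defs
  imports Complex_Main "HOL-Computational_Algebra.Polynomial"
begin

end

theory Submission
  imports Defs "HOL-Complex_Analysis.Complex_Analysis"
begin

text \<open>
  Let \<open>T\<close> be the Chebyshev polynomial of degree \<open>n\<close> and \<open>Q u = u + i e T u\<close> with a small \<open>e > 0\<close>.
  Off the real axis, \<open>cnj u = Q u\<close> forces \<open>u\<close> onto one of the \<open>n - 1\<close> hyperbolas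
  \<open>u = cos (k pi / n + i b)\<close> on which \<open>T\<close> is real, and on each of them \<open>b\<close> solves an equation
  \<open>cosh (n t) = C sinh t\<close> with two simple roots; together with the \<open>n\<close> real roots of \<open>T\<close> this gives
  \<open>3 n - 2\<close> solutions, all nondegenerate (\<open>\<bar>Q' u\<bar> \<noteq> 1\<close>). For \<open>d > 0\<close>, the equation
  \<open>(1 - d Q u) (1 + d cnj u) = 1\<close> is the perturbation \<open>cnj u - Q u = d (cnj u) (Q u)\<close>; for small \<open>d\<close>
  it has one solution near each of these, exactly one more near infinity, and no others.
\<close>

section \<open>Persistence of nondegenerate zeros\<close>

text \<open>Newton's iteration with the derivative frozen at \<open>z\<close>, i.e.
  \<open>u - M (F u)\<close>, is a contraction of a small disc into itself. \<open>L\<close> is only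
  real-linear, so that conjugation is allowed. The radius \<open>r\<close> stays free below
  \<open>r0\<close> because the discs around different zeros must later be shrunk to be
  disjoint.\<close>

lemma perturbed_zero_unique:
  fixes f g :: "complex \<Rightarrow> complex" and L M :: "complex \<Rightarrow> complex"
  assumes zero: "f z = 0"
    and L: "bounded_linear L" and M: "bounded_linear M"
    and inv1: "\<And>h. M (L h) = h" and inv2: "\<And>h. L (M h) = h"
    and strict: "\<And>e. e > 0 \<Longrightarrow> \<exists>r>0. \<forall>u\<in>cball z r. \<forall>v\<in>cball z r.
           norm (f u - f v - L (u - v)) \<le> e * norm (u - v)"
    and g: "r1 > 0" "B-lipschitz_on (cball z r1) g"
  shows "\<exists>r0>0. \<forall>r. 0 < r \<and> r \<le> r0 \<longrightarrow>
           (\<forall>\<^sub>F d in at_right 0. \<exists>!u. u \<in> cball z r \<and> f u + of_real d * g u = 0)"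
proof -
  obtain K where K: "K > 0" "\<And>h. norm (M h) \<le> norm h * K"
    using bounded_linear.pos_bounded[OF M] by blast
  \<comment> \<open>The remainder of \<open>f\<close> and the term \<open>d * g\<close> each get
    Lipschitz constant at most \<open>e\<close>; after applying \<open>M\<close> the total is
    \<open>2 * e * K = 1/2\<close>.\<close>
  define e where "e = 1 / (4 * K)"
  have e: "e > 0" using K by (simp add: e_def)
  obtain r2 where r2: "r2 > 0" and lip: "\<And>u v. u \<in> cball z r2 \<Longrightarrow> v \<in> cball z r2 \<Longrightarrow>
           norm (f u - f v - L (u - v)) \<le> e * norm (u - v)"
    using strict[OF e] by blast
  show ?thesis
  proof (rule exI[of _ "min r1 r2"], safe)
    show "min r1 r2 > 0" using g r2 by simp
    fix r assume r: "0 < r" "r \<le> min r1 r2"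
    have lim1: "((\<lambda>d. d * B) \<longlongrightarrow> 0 * B) (at_right 0)"
      by (intro tendsto_intros)
    have lim2: "((\<lambda>d. d * norm (g z) * K) \<longlongrightarrow> 0 * norm (g z) * K) (at_right 0)"
      by (intro tendsto_intros)
    have ev1: "\<forall>\<^sub>F d in at_right 0. d * B < e"
      using order_tendstoD(2)[OF lim1, of e] e by simp
    \<comment> \<open>The centre moves by less than \<open>r / 2\<close>; contraction by
      \<open>1/2\<close> uses up the other half of the radius.\<close>
    have ev2: "\<forall>\<^sub>F d in at_right 0. d * norm (g z) * K < r / 2"
      using order_tendstoD(2)[OF lim2, of "r / 2"] r by simp
    have ev3: "\<forall>\<^sub>F d in at_right (0::real). d > 0"
      by (simp add: eventually_at_right_less)
    from ev1 ev2 ev3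
    show "\<forall>\<^sub>F d in at_right 0. \<exists>!u. u \<in> cball z r \<and> f u + of_real d * g u = 0"
    proof eventually_elim
      case (elim d)
      define F where "F = (\<lambda>u. f u + of_real d * g u)"
      define T where "T = (\<lambda>u. u - M (F u))"
      have T_lip: "dist (T u) (T v) \<le> 1/2 * dist u v" if "u \<in> cball z r" "v \<in> cball z r" for u v
      proof -
        have "norm (F u - F v - L (u - v)) \<le> norm (f u - f v - L (u - v)) + norm (of_real d * (g u - g v))"
          unfolding F_def by (rule order_trans[OF _ norm_triangle_ineq]) (simp add: algebra_simps)
        also have "\<dots> \<le> e * norm (u - v) + d * (B * norm (u - v))"
          using that r elim lip[of u v] lipschitz_onD[OF g(2), of u v]
          by (intro add_mono) (auto simp: norm_mult dist_norm)
        also have "\<dots> \<le> (2 * e) * norm (u - v)"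
          using elim mult_right_mono[of "d * B" e "norm (u - v)"] by (simp add: algebra_simps)
        finally have *: "norm (F u - F v - L (u - v)) \<le> (2 * e) * norm (u - v)" .
        have "T u - T v = M (L (u - v) - (F u - F v))"
          unfolding T_def using bounded_linear.linear[OF M] by (simp add: linear_diff inv1)
        also have "norm \<dots> \<le> norm (L (u - v) - (F u - F v)) * K" by (rule K)
        also have "\<dots> \<le> (2 * e) * norm (u - v) * K"
          using * K(1) by (intro mult_right_mono) (simp_all add: norm_minus_commute)
        also have "\<dots> = 1/2 * norm (u - v)" using K(1) by (simp add: e_def)
        finally show ?thesis by (simp add: dist_norm)
      qed
      have Tz: "dist z (T z) \<le> r / 2"
      proof -
        have "dist z (T z) = norm (M (of_real d * g z))"
          by (simp add: T_def F_def zero dist_norm)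
        also have "\<dots> \<le> norm (of_real d * g z) * K" by (rule K)
        finally show ?thesis using elim by (simp add: norm_mult)
      qed
      have T_into: "T u \<in> cball z r" if "u \<in> cball z r" for u
      proof -
        have "dist z (T u) \<le> dist z (T z) + dist (T z) (T u)" by (rule dist_triangle)
        also have "\<dots> \<le> r / 2 + 1/2 * dist z u"
          using Tz T_lip[of z u] that r by (intro add_mono) auto
        finally show ?thesis using that by auto
      qed
      have ex1: "\<exists>!u\<in>cball z r. T u = u"
        by (rule Banach_fix[where c = "1/2"])
           (use r T_lip T_into in \<open>auto simp: complete_eq_closed\<close>)
      \<comment> \<open>Fixed points satisfy \<open>M (F u) = 0\<close>, and \<open>M\<close> is
        injective.\<close>
      have "T u = u \<longleftrightarrow> F u = 0" for u
        unfolding T_def by (metis inv2 M bounded_linear.linear diff_0_right diff_eq_eq linear_0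
            add_cancel_right_right L)
      then show ?case using ex1 unfolding F_def by auto
    qed
  qed
qed

text \<open>Near \<open>z\<close> the function \<open>f w - deriv f z * w\<close> has derivative of
  norm at most \<open>e\<close>, by continuity of \<open>deriv f\<close>; the mean value inequality
  on the convex disc finishes.\<close>

lemma holomorphic_strictly_differentiable:
  assumes "f holomorphic_on S" "open S" "z \<in> S" "e > 0"
  shows "\<exists>r>0. \<forall>u\<in>cball z r. \<forall>v\<in>cball z r.
           norm (f u - f v - deriv f z * (u - v)) \<le> e * norm (u - v)"
proof -
  have "continuous_on S (deriv f)"
    using assms holomorphic_deriv holomorphic_on_imp_continuous_on by blast
  then have "isCont (deriv f) z"
    using assms by (simp add: continuous_on_eq_continuous_at)
  then obtain s where s: "s > 0" "\<And>u. dist u z < s \<Longrightarrow> dist (deriv f u) (deriv f z) < e"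
    using assms(4) unfolding continuous_at_eps_delta by blast
  obtain t where t: "t > 0" "ball z t \<subseteq> S" using assms openE by blast
  define r where "r = min s t / 2"
  have r: "r > 0" "r < s" "r < t" using s t by (auto simp: r_def)
  have "norm (f u - f v - deriv f z * (u - v)) \<le> e * norm (u - v)"
    if "u \<in> cball z r" "v \<in> cball z r" for u v
  proof -
    have "norm ((f u - deriv f z * u) - (f v - deriv f z * v)) \<le> e * norm (u - v)"
    proof (rule field_differentiable_bound[where S = "cball z r" and f' = "\<lambda>w. deriv f w - deriv f z"])
      fix w assume w: "w \<in> cball z r"
      then have "w \<in> S" using t r by auto
      then have "(f has_field_derivative deriv f w) (at w)"
        using assms holomorphic_derivI by blast
      then show "((\<lambda>w. f w - deriv f z * w) has_field_derivative deriv f w - deriv f z) (at w within cball z r)"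
        by (rule has_field_derivative_at_within[OF DERIV_diff[OF _ DERIV_cmult_Id]])
      show "norm (deriv f w - deriv f z) \<le> e"
        using s(2)[of w] w r by (auto simp: dist_norm norm_minus_commute)
    qed (use that in auto)
    then show ?thesis by (simp add: algebra_simps)
  qed
  then show ?thesis using r by blast
qed

lemma eventually_at_right_0_less: "c > 0 \<Longrightarrow> \<forall>\<^sub>F x in at_right (0::real). x < c"
  using order_tendstoD(2)[OF tendsto_ident_at] by blast

text \<open>Combining \<open>k = cnj h - a * h\<close> with its conjugate eliminates
  \<open>cnj h\<close>: \<open>cnj k + cnj a * k = h * (1 - a * cnj a)\<close>. So \<open>L\<close>
  is invertible as soon as the modulus of \<open>a\<close> is not 1.\<close>

lemma conj_linear_inverse:
  fixes a :: complex
  assumes "norm a \<noteq> 1"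
  defines "L \<equiv> \<lambda>h. cnj h - a * h" and "M \<equiv> \<lambda>k. (cnj k + cnj a * k) / (1 - a * cnj a)"
  shows "bounded_linear L" "bounded_linear M" "M (L h) = h" "L (M h) = h"
proof -
  have "a * cnj a \<noteq> 1"
  proof
    assume "a * cnj a = 1"
    then have "norm (a * cnj a) = 1" by simp
    then have "(norm a)\<^sup>2 = 1" by (simp add: norm_mult power2_eq_square)
    then show False using assms by (simp add: power2_eq_1_iff) (smt (verit) norm_ge_zero)
  qed
  then have nz: "1 - a * cnj a \<noteq> 0" by simp
  show "bounded_linear L" unfolding L_def
    by (intro bounded_linear_sub bounded_linear_cnj bounded_linear_const_mult bounded_linear_ident)
  show "bounded_linear M" unfolding M_def divide_inverse
    by (intro bounded_linear_mult_const bounded_linear_add bounded_linear_cnj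
        bounded_linear_const_mult bounded_linear_ident)
  show "M (L h) = h" unfolding L_def M_def using nz by (simp add: divide_eq_eq algebra_simps)
  have "cnj (1 - a * cnj a) = 1 - a * cnj a" by (simp add: mult.commute)
  then have "L (M h) = ((h + a * cnj h) - a * (cnj h + cnj a * h)) / (1 - a * cnj a)"
    unfolding L_def M_def complex_cnj_divide by (simp add: diff_divide_distrib)
  also have "\<dots> = h * (1 - a * cnj a) / (1 - a * cnj a)" by (simp add: algebra_simps)
  finally show "L (M h) = h" using nz by simp
qed

lemma norm_inverse_le_of_ge:
  fixes u :: "'a :: real_normed_div_algebra"
  assumes "1 / r \<le> norm u" "0 < r"
  shows "norm (inverse u) \<le> r"
  using le_imp_inverse_le[OF assms(1)] assms(2) by (simp add: norm_inverse)

text \<open>The real derivative of \<open>cnj u - Q u\<close> at \<open>z\<close> is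
  \<open>cnj h - a * h\<close> with \<open>a = Q' z\<close>, invertible by \<open>nd\<close>; the
  perturbing term is Lipschitz on a disc, being a product of bounded Lipschitz functions.\<close>

lemma zero_near_nondegenerate:
  fixes Q :: "complex poly"
  assumes z: "cnj z = poly Q z" and nd: "norm (poly (pderiv Q) z) \<noteq> 1"
  shows "\<exists>r0>0. \<forall>r. 0 < r \<and> r \<le> r0 \<longrightarrow> (\<forall>\<^sub>F d in at_right 0.
           \<exists>!u. u \<in> cball z r \<and> (cnj u - poly Q u) + of_real d * - (cnj u * poly Q u) = 0)"
proof -
  define a where "a = poly (pderiv Q) z"
  have a: "norm a \<noteq> 1" using nd by (simp add: a_def)
  have strictQ: "\<exists>r>0. \<forall>u\<in>cball z r. \<forall>v\<in>cball z r.
           norm (poly Q u - poly Q v - a * (u - v)) \<le> e * norm (u - v)" if "e > 0" for e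
  proof -
    have "deriv (poly Q) z = a" unfolding a_def by (rule DERIV_imp_deriv[OF poly_DERIV])
    moreover have "poly Q holomorphic_on UNIV" by (intro holomorphic_intros)
    ultimately show ?thesis
      using holomorphic_strictly_differentiable[of "poly Q" UNIV z e] that by simp
  qed
  obtain r1 where r1: "r1 > 0" and Q1: "\<And>u v. u \<in> cball z r1 \<Longrightarrow> v \<in> cball z r1 \<Longrightarrow>
           norm (poly Q u - poly Q v - a * (u - v)) \<le> 1 * norm (u - v)"
    using strictQ[of 1] by auto
  have Qlip: "norm (poly Q u - poly Q v) \<le> (1 + norm a) * norm (u - v)"
    if "u \<in> cball z r1" "v \<in> cball z r1" for u v
  proof -
    have "norm (poly Q u - poly Q v) \<le> norm (a * (u - v)) + norm (poly Q u - poly Q v - a * (u - v))"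
      by (rule norm_triangle_sub)
    also have "\<dots> \<le> norm a * norm (u - v) + 1 * norm (u - v)"
      unfolding norm_mult by (intro add_left_mono Q1 that)
    finally show ?thesis by (simp add: distrib_right add.commute)
  qed
  have "compact (poly Q ` cball z r1)"
    by (intro compact_continuous_image continuous_intros) auto
  then obtain B where B: "\<And>u. u \<in> cball z r1 \<Longrightarrow> norm (poly Q u) \<le> B"
    using compact_imp_bounded bounded_iff by (metis imageI)
  have B0: "B \<ge> 0" using order_trans[OF norm_ge_zero B[of z]] r1 by simp
  have glip: "(B + (norm z + r1) * (1 + norm a))-lipschitz_on (cball z r1) (\<lambda>u. - (cnj u * poly Q u))"
  proof (rule lipschitz_onI)
    fix u v assume uv: "u \<in> cball z r1" "v \<in> cball z r1"
    have "norm v \<le> norm z + r1"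
      using uv(2) norm_triangle_sub[of v z] by (auto simp: dist_norm norm_minus_commute)
    have "dist (- (cnj u * poly Q u)) (- (cnj v * poly Q v)) =
        norm (cnj (u - v) * poly Q u + cnj v * (poly Q u - poly Q v))"
      by (simp add: dist_norm norm_minus_commute algebra_simps)
    also have "\<dots> \<le> norm (cnj (u - v) * poly Q u) + norm (cnj v * (poly Q u - poly Q v))"
      by (rule norm_triangle_ineq)
    also have "\<dots> = norm (u - v) * norm (poly Q u) + norm v * norm (poly Q u - poly Q v)"
      by (simp only: norm_mult complex_mod_cnj)
    also have "\<dots> \<le> norm (u - v) * B + (norm z + r1) * ((1 + norm a) * norm (u - v))"
      using B[OF uv(1)] Qlip[OF uv] \<open>norm v \<le> norm z + r1\<close> r1 by (intro add_mono mult_mono) auto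
    finally show "dist (- (cnj u * poly Q u)) (- (cnj v * poly Q v)) \<le>
        (B + (norm z + r1) * (1 + norm a)) * dist u v"
      by (simp add: dist_norm algebra_simps)
  qed (use B0 r1 in auto)
  show ?thesis
  proof (rule perturbed_zero_unique[OF _ conj_linear_inverse[OF a] _ r1 glip])
    show "cnj z - poly Q z = 0" using z by simp
    fix e :: real assume "e > 0"
    \<comment> \<open>Conjugation is additive, so only the remainder of \<open>Q\<close>
      survives.\<close>
    have *: "cnj u - poly Q u - (cnj v - poly Q v) - (cnj (u - v) - a * (u - v)) =
        - (poly Q u - poly Q v - a * (u - v))" for u v by simp
    show "\<exists>r>0. \<forall>u\<in>cball z r. \<forall>v\<in>cball z r.
      norm (cnj u - poly Q u - (cnj v - poly Q v) - (cnj (u - v) - a * (u - v))) \<le> e * norm (u - v)"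
      unfolding * norm_minus_cancel by (rule strictQ[OF \<open>e > 0\<close>])
  qed
qed

text \<open>The coordinate at infinity is \<open>s = 1 / cnj u\<close>; there the equation
  \<open>cnj u - Q u = d * cnj u * Q u\<close> reads \<open>s - H (cnj s) + d = 0\<close> with \<open>H t = 1 / Q (1 / t)\<close>,
  and \<open>H\<close> vanishes to order \<open>degree Q \<ge> 2\<close> at \<open>0\<close>.\<close>
lemma zero_near_infinity:
  fixes Q :: "complex poly"
  assumes deg: "degree Q > 1"
  shows "\<exists>r0>0. \<forall>r. 0 < r \<and> r \<le> r0 \<longrightarrow> (\<forall>\<^sub>F d in at_right 0.
           \<exists>!u. norm u \<ge> 1 / r \<and> (cnj u - poly Q u) + of_real d * - (cnj u * poly Q u) = 0)"
proof -
  define n where "n = degree Q"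
  \<comment> \<open>\<open>P t = t ^ n * Q (1 / t)\<close> takes the leading coefficient of
    \<open>Q\<close> as its value at 0, so \<open>t ^ n / P t\<close> extends
    \<open>1 / Q (1 / t)\<close> holomorphically across 0.\<close>
  define P where "P = reflect_poly Q"
  define H where "H = (\<lambda>t. t ^ n / poly P t)"
  have "Q \<noteq> 0" using deg by auto
  then have P0: "poly P 0 \<noteq> 0" by (simp add: P_def)
  have "isCont (poly P) 0" by simp
  then obtain t0 where t0: "t0 > 0" "\<And>t. norm t < t0 \<Longrightarrow> poly P t \<noteq> 0"
    using P0 continuous_at_avoid[of 0 "poly P" 0] by (auto simp: dist_norm)
  have hol: "H holomorphic_on ball 0 t0"
    unfolding H_def using t0 by (intro holomorphic_intros) auto
  \<comment> \<open>Here \<open>n > 1\<close> enters: the linear part of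
    \<open>s - H (cnj s)\<close> at 0 is the identity.\<close>
  have "(H has_field_derivative 0) (at 0)"
    unfolding H_def using P0 deg by (auto intro!: derivative_eq_intros simp: n_def power_0_left)
  then have dH: "deriv H 0 = 0" by (rule DERIV_imp_deriv)
  have H0: "H 0 = 0" using deg by (simp add: H_def n_def)
  have "\<exists>r0>0. \<forall>r. 0 < r \<and> r \<le> r0 \<longrightarrow> (\<forall>\<^sub>F d in at_right 0.
           \<exists>!s. s \<in> cball 0 r \<and> (s - H (cnj s)) + of_real d * (\<lambda>_. 1) s = 0)"
  proof (rule perturbed_zero_unique[OF _ bounded_linear_ident bounded_linear_ident refl refl])
    show "0 - H (cnj 0) = 0" by (simp add: H0)
    show "(1::real) > 0" by simp
    show "0-lipschitz_on (cball 0 1) (\<lambda>_::complex. 1::complex)" by (intro lipschitz_intros)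
    fix e :: real assume "e > 0"
    then obtain r where r: "r > 0" and H: "\<And>u v. u \<in> cball 0 r \<Longrightarrow> v \<in> cball 0 r \<Longrightarrow>
        norm (H u - H v) \<le> e * norm (u - v)"
      using holomorphic_strictly_differentiable[OF hol, of 0 e] t0 dH by auto
    have "norm (u - H (cnj u) - (v - H (cnj v)) - (u - v)) \<le> e * norm (u - v)"
      if "u \<in> cball 0 r" "v \<in> cball 0 r" for u v
    proof -
      have "norm (u - H (cnj u) - (v - H (cnj v)) - (u - v)) = norm (H (cnj u) - H (cnj v))"
        by (simp add: norm_minus_commute)
      also have "\<dots> \<le> e * norm (cnj u - cnj v)" using that by (intro H) auto
      also have "\<dots> = e * norm (u - v)" by (metis complex_cnj_diff complex_mod_cnj)
      finally show ?thesis .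
    qed
    then show "\<exists>r>0. \<forall>u\<in>cball 0 r. \<forall>v\<in>cball 0 r.
        norm (u - H (cnj u) - (v - H (cnj v)) - (u - v)) \<le> e * norm (u - v)" using r by blast
  qed
  then obtain r0 where r0: "r0 > 0" and ev: "\<And>r. 0 < r \<Longrightarrow> r \<le> r0 \<Longrightarrow> \<forall>\<^sub>F d in at_right 0.
           \<exists>!s. s \<in> cball 0 r \<and> (s - H (cnj s)) + of_real d = 0" by auto
  show ?thesis
  proof (rule exI[of _ "min r0 (t0 / 2)"], safe)
    show "min r0 (t0 / 2) > 0" using r0 t0 by simp
    fix r assume r: "0 < r" "r \<le> min r0 (t0 / 2)"
    \<comment> \<open>The two sides differ by the factor \<open>- (cnj u * Q u)\<close>, nonzero
      because \<open>r < t0\<close> keeps \<open>P\<close> away from 0 at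
      \<open>1 / u\<close>.\<close>
    have iff: "cnj u - poly Q u + of_real d * - (cnj u * poly Q u) = 0 \<longleftrightarrow>
        inverse (cnj u) - H (cnj (inverse (cnj u))) + of_real d = 0"
      if u: "norm u \<ge> 1 / r" for u d
    proof -
      have "u \<noteq> 0" using u r by (auto simp: field_simps)
      have "norm (inverse u) \<le> r" using u r by (intro norm_inverse_le_of_ge) auto
      then have "poly P (inverse u) \<noteq> 0" using t0 r by simp
      moreover have P: "poly P (inverse u) = inverse u ^ n * poly Q u"
        unfolding P_def n_def using \<open>u \<noteq> 0\<close> by (subst poly_reflect_poly_nz) auto
      ultimately have Q: "poly Q u \<noteq> 0" by auto
      have H: "H (cnj (inverse (cnj u))) = 1 / poly Q u"
        using \<open>u \<noteq> 0\<close> by (simp add: H_def P)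
      have "cnj u - poly Q u + of_real d * - (cnj u * poly Q u) =
          - (cnj u * poly Q u) * (inverse (cnj u) - 1 / poly Q u + of_real d)"
        using \<open>u \<noteq> 0\<close> Q by (simp add: field_simps)
      then show ?thesis unfolding H using \<open>u \<noteq> 0\<close> Q by simp
    qed
    have "\<forall>\<^sub>F d in at_right (0::real). d > 0" by (simp add: eventually_at_right_less)
    moreover have "\<forall>\<^sub>F d in at_right 0. \<exists>!s. s \<in> cball 0 r \<and> (s - H (cnj s)) + of_real d = 0"
      using ev r by simp
    ultimately show "\<forall>\<^sub>F d in at_right 0.
        \<exists>!u. norm u \<ge> 1 / r \<and> (cnj u - poly Q u) + of_real d * - (cnj u * poly Q u) = 0"
    proof eventually_elim
      case (elim d)
      from elim(2) obtain s where s: "norm s \<le> r \<and> s - H (cnj s) + of_real d = 0"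
        and uniq: "\<forall>s'. norm s' \<le> r \<and> s' - H (cnj s') + of_real d = 0 \<longrightarrow> s' = s"
        unfolding mem_cball_0 by (rule ex1E)
      \<comment> \<open>At \<open>s = 0\<close> the equation would read \<open>d = 0\<close>; hence
        the root found is a finite point \<open>u\<close>.\<close>
      have "s \<noteq> 0" using s H0 elim(1) by auto
      show ?case
      proof (rule ex1I[of _ "inverse (cnj s)"])
        have "norm (inverse (cnj s)) \<ge> 1 / r"
          using s r \<open>s \<noteq> 0\<close> le_imp_inverse_le[of "norm s" r]
          by (simp add: norm_inverse norm_divide inverse_eq_divide)
        then show "1 / r \<le> norm (inverse (cnj s)) \<and>
            cnj (inverse (cnj s)) - poly Q (inverse (cnj s)) +
              of_real d * - (cnj (inverse (cnj s)) * poly Q (inverse (cnj s))) = 0"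
          using iff[of "inverse (cnj s)" d] s by simp
      next
        fix u assume u: "1 / r \<le> norm u \<and> cnj u - poly Q u + of_real d * - (cnj u * poly Q u) = 0"
        then have "u \<noteq> 0" using r by (auto simp: field_simps)
        have "norm (inverse (cnj u)) \<le> r" using u r by (intro norm_inverse_le_of_ge) auto
        moreover have "inverse (cnj u) - H (cnj (inverse (cnj u))) + of_real d = 0"
          using u iff[of u d] by simp
        ultimately have "inverse (cnj u) = s" using uniq by blast
        then show "u = inverse (cnj s)" by (metis complex_cnj_cnj complex_cnj_inverse inverse_inverse_eq)
      qed
    qed
  qed
qed

section \<open>Global count of the perturbed zeros\<close>

text \<open>Small discs about \<open>Z\<close> and the exterior of a large disc carry one zero each.
  On the compact remainder the modulus of \<open>cnj u - Q u\<close> has a positive lower bound,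
  which the perturbation cannot reach for small \<open>d\<close>.\<close>

theorem card_perturbed_zeros:
  fixes Q :: "complex poly"
  defines "Z \<equiv> {u. cnj u = poly Q u}"
  assumes deg: "degree Q > 1" and fin: "finite Z"
    and nd: "\<And>u. u \<in> Z \<Longrightarrow> norm (poly (pderiv Q) u) \<noteq> 1"
  shows "\<forall>\<^sub>F d in at_right 0.
      card {u. (cnj u - poly Q u) + of_real d * - (cnj u * poly Q u) = 0} = card Z + 1"
proof -
  define F where "F = (\<lambda>d u. (cnj u - poly Q u) + of_real d * - (cnj u * poly Q u))"
  obtain i0 where i0: "i0 > 0" and inf: "\<And>r. 0 < r \<Longrightarrow> r \<le> i0 \<Longrightarrow>
      \<forall>\<^sub>F d in at_right 0. \<exists>!u. norm u \<ge> 1 / r \<and> F d u = 0"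
    using zero_near_infinity[OF deg] unfolding F_def by blast
  obtain N where N: "N > 0" "\<And>z. z \<in> Z \<Longrightarrow> norm z \<le> N"
    using finite_imp_bounded[OF fin] unfolding bounded_pos by blast
  \<comment> \<open>Large enough for the exterior to contain just one zero, and for all of
    \<open>Z\<close> to lie strictly inside.\<close>
  define R where "R = max (1 / i0) (N + 1)"
  have "1 / i0 \<le> R" "N + 1 \<le> R" by (auto simp: R_def)
  have R: "R > 0" "1 / R \<le> i0" "\<And>z. z \<in> Z \<Longrightarrow> norm z < R"
  proof -
    show "R > 0" using \<open>N + 1 \<le> R\<close> N(1) by linarith
    then show "1 / R \<le> i0" using \<open>1 / i0 \<le> R\<close> i0 by (simp add: field_simps)
    show "norm z < R" if "z \<in> Z" for z using \<open>N + 1 \<le> R\<close> N(2)[OF that] by linarith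
  qed
  have inf: "\<forall>\<^sub>F d in at_right 0. \<exists>!u. norm u \<ge> R \<and> F d u = 0"
    using inf[of "1 / R"] R by simp
  have "\<forall>z\<in>Z. \<exists>r0>0. \<forall>r. 0 < r \<and> r \<le> r0 \<longrightarrow> (\<forall>\<^sub>F d in at_right 0. \<exists>!u. u \<in> cball z r \<and> F d u = 0)"
    unfolding F_def using zero_near_nondegenerate nd by (auto simp: Z_def)
  from bchoice[OF this] obtain r0 where "\<forall>z\<in>Z. r0 z > 0 \<and> (\<forall>r. 0 < r \<and> r \<le> r0 z \<longrightarrow>
      (\<forall>\<^sub>F d in at_right 0. \<exists>!u. u \<in> cball z r \<and> F d u = 0))" ..
  then have r0: "\<And>z. z \<in> Z \<Longrightarrow> r0 z > 0"
    and loc: "\<And>z r. z \<in> Z \<Longrightarrow> 0 < r \<Longrightarrow> r \<le> r0 z \<Longrightarrow>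
        \<forall>\<^sub>F d in at_right 0. \<exists>!u. u \<in> cball z r \<and> F d u = 0" by simp_all
  \<comment> \<open>The three bounds give local uniqueness, separation from the exterior region, and
    disjointness of the discs.\<close>
  have "\<forall>\<^sub>F r in at_right 0. \<forall>z\<in>Z. r < r0 z \<and> r < R - norm z \<and> (\<forall>y\<in>Z - {z}. r < dist z y / 2)"
    using fin r0 R(3)
    by (intro eventually_ball_finite ballI eventually_conj eventually_at_right_0_less) auto
  moreover have "\<forall>\<^sub>F r in at_right (0::real). r > 0" by (simp add: eventually_at_right_less)
  ultimately have "\<forall>\<^sub>F r in at_right 0. r > 0 \<and>
      (\<forall>z\<in>Z. r < r0 z \<and> r < R - norm z \<and> (\<forall>y\<in>Z - {z}. r < dist z y / 2))"
    by eventually_elim auto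
  then obtain r where r: "r > 0" "\<And>z. z \<in> Z \<Longrightarrow> r < r0 z" "\<And>z. z \<in> Z \<Longrightarrow> r < R - norm z"
    "\<And>y z. y \<in> Z \<Longrightarrow> z \<in> Z \<Longrightarrow> y \<noteq> z \<Longrightarrow> r < dist z y / 2"
    using eventually_happens'[OF trivial_limit_at_right_real] by (smt (verit) Diff_iff singletonD)
  have loc: "\<forall>\<^sub>F d in at_right 0. \<forall>z\<in>Z. \<exists>!u. u \<in> cball z r \<and> F d u = 0"
    using fin loc r by (intro eventually_ball_finite) (auto simp: less_imp_le)
  \<comment> \<open>Removing open balls keeps \<open>K\<close> compact. It overlaps the closed discs
    and the exterior only in boundary circles, which is harmless since no perturbed zero lies in
    \<open>K\<close>.\<close>
  define K where "K = cball 0 R - (\<Union>z\<in>Z. ball z r)"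
  have K: "compact K" unfolding K_def by (intro compact_diff compact_cball open_UN) auto
  have "\<exists>m>0. \<forall>u\<in>K. norm (cnj u - poly Q u) \<ge> m"
  proof (cases "K = {}")
    case False
    have "continuous_on K (\<lambda>u. norm (cnj u - poly Q u))" by (intro continuous_intros)
    then obtain x where x: "x \<in> K" "\<And>u. u \<in> K \<Longrightarrow> norm (cnj x - poly Q x) \<le> norm (cnj u - poly Q u)"
      using continuous_attains_inf[OF K False] by blast
    have "x \<notin> Z" using x(1) r(1) by (auto simp: K_def)
    then show ?thesis using x by (intro exI[of _ "norm (cnj x - poly Q x)"]) (auto simp: Z_def)
  qed (auto intro: exI[of _ 1])
  then obtain m where m: "m > 0" "\<And>u. u \<in> K \<Longrightarrow> norm (cnj u - poly Q u) \<ge> m" by blast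
  have "compact ((\<lambda>u. cnj u * poly Q u) ` K)"
    using K by (intro compact_continuous_image continuous_intros)
  then have "bounded ((\<lambda>u. cnj u * poly Q u) ` K)" by (rule compact_imp_bounded)
  then obtain B where B: "B > 0" "\<And>u. u \<in> K \<Longrightarrow> norm (cnj u * poly Q u) \<le> B"
    unfolding bounded_pos by blast
  have small: "\<forall>\<^sub>F d in at_right 0. d < m / B"
    using m B by (intro eventually_at_right_0_less) simp
  have pos: "\<forall>\<^sub>F d in at_right (0::real). d > 0" by (simp add: eventually_at_right_less)
  from inf loc small pos show ?thesis
  proof eventually_elim
    case (elim d)
    define A where "A = {u. F d u = 0}"
    have "u \<notin> K" if "u \<in> A" for u
    proof
      assume "u \<in> K"
      have "cnj u - poly Q u = of_real d * (cnj u * poly Q u)" using that by (simp add: A_def F_def)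
      then have "norm (cnj u - poly Q u) = d * norm (cnj u * poly Q u)"
        using elim(4) by (simp add: norm_mult)
      also have "\<dots> \<le> d * B" using elim(4) B(2)[OF \<open>u \<in> K\<close>] by (intro mult_left_mono) auto
      also have "\<dots> < m" using elim(3) B(1) by (simp add: field_simps)
      finally show False using m(2)[OF \<open>u \<in> K\<close>] by simp
    qed
    then have A_eq: "A = (\<Union>z\<in>Z. A \<inter> cball z r) \<union> {u \<in> A. norm u \<ge> R}"
      by (force simp: K_def)
    have card1: "card (A \<inter> cball z r) = 1" "finite (A \<inter> cball z r)" if "z \<in> Z" for z
    proof -
      from elim(2) that have "\<exists>!u. u \<in> cball z r \<and> F d u = 0" by (rule bspec)
      then obtain u where "u \<in> cball z r \<and> F d u = 0"
        "\<forall>v. v \<in> cball z r \<and> F d v = 0 \<longrightarrow> v = u" by (rule ex1E)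
      then have "A \<inter> cball z r = {u}" unfolding A_def by blast
      then show "card (A \<inter> cball z r) = 1" "finite (A \<inter> cball z r)" by auto
    qed
    have disj: "cball y r \<inter> cball z r = {}" if "y \<in> Z" "z \<in> Z" "y \<noteq> z" for y z
    proof (rule ccontr)
      assume "cball y r \<inter> cball z r \<noteq> {}"
      then obtain u where "dist y u \<le> r" "dist z u \<le> r" by auto
      then have "dist z y \<le> 2 * r" using dist_triangle2[of z y u] by (simp add: dist_commute)
      then show False using r(4)[OF that] by simp
    qed
    have "card (\<Union>z\<in>Z. A \<inter> cball z r) = (\<Sum>z\<in>Z. card (A \<inter> cball z r))"
    proof (intro card_UN_disjoint fin ballI impI card1(2))
      show "(A \<inter> cball y r) \<inter> (A \<inter> cball z r) = {}" if "y \<in> Z" "z \<in> Z" "y \<noteq> z" for y z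
        using disj[OF that] by blast
    qed
    then have cardZ: "card (\<Union>z\<in>Z. A \<inter> cball z r) = card Z" using card1 by simp
    from elim(1) obtain u where "norm u \<ge> R \<and> F d u = 0"
      "\<forall>v. norm v \<ge> R \<and> F d v = 0 \<longrightarrow> v = u" by (rule ex1E)
    then have "{u \<in> A. norm u \<ge> R} = {u}" unfolding A_def by blast
    moreover have "(\<Union>z\<in>Z. A \<inter> cball z r) \<inter> {u \<in> A. norm u \<ge> R} = {}"
    proof -
      have "norm u < R" if "z \<in> Z" "u \<in> cball z r" for u z
        using r(3)[OF that(1)] that(2) norm_triangle_sub[of u z] by (auto simp: dist_norm norm_minus_commute)
      then show ?thesis by fastforce
    qed
    moreover have "finite (\<Union>z\<in>Z. A \<inter> cball z r)" using fin card1(2) by (rule finite_UN_I)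
    ultimately have "card ((\<Union>z\<in>Z. A \<inter> cball z r) \<union> {u \<in> A. norm u \<ge> R}) = card Z + 1"
      by (simp only: card_Un_disjoint finite.intros cardZ) simp
    then have "card A = card Z + 1" by (simp only: A_eq[symmetric])
    then show ?case by (simp add: A_def F_def)
  qed
qed

section \<open>A harmonic polynomial with \<open>3 n - 2\<close> zeros\<close>

text \<open>The quotient \<open>f t = cosh (n t) / sinh t\<close> falls and then rises, and exceeds
  \<open>C\<close> on both sides of its minimum at \<open>m\<close>. The numerator \<open>g\<close>
  of its derivative is strictly increasing, so \<open>m\<close> is the only critical point. The
  hypothesis says \<open>C > f 1\<close>, hence \<open>C > f m\<close>: there is one root on each
  side of \<open>m\<close>, and neither is critical.\<close>

lemma two_sinh_cosh_roots:
  fixes n :: nat and C :: real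
  assumes n: "n > 1" and C: "C > cosh (real n) / sinh 1"
  shows "card {t. t > 0 \<and> C * sinh t = cosh (real n * t)} = 2"
    and "\<And>t. t > 0 \<Longrightarrow> C * sinh t = cosh (real n * t) \<Longrightarrow> C * cosh t \<noteq> real n * sinh (real n * t)"
proof -
  define f where "f = (\<lambda>t::real. cosh (real n * t) / sinh t)"
  define g where "g = (\<lambda>t::real. real n * sinh (real n * t) * sinh t - cosh (real n * t) * cosh t)"
  have dg: "(g has_real_derivative ((real n)\<^sup>2 - 1) * (cosh (real n * t) * sinh t)) (at t)" for t
    unfolding g_def by (auto intro!: derivative_eq_intros simp: algebra_simps power2_eq_square)
  have n2: "(real n)\<^sup>2 > 1" using n by (simp add: one_less_power)
  have g_mono: "g s < g t" if "0 \<le> s" "s < t" for s t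
  proof (rule DERIV_pos_imp_increasing_open[OF that(2)])
    show "\<exists>y. (g has_real_derivative y) (at x) \<and> 0 < y" if "s < x" "x < t" for x
      using dg[of x] n2 that \<open>0 \<le> s\<close> by (intro exI[of _ "((real n)\<^sup>2 - 1) * (cosh (real n * x) * sinh x)"]) auto
    show "continuous_on {s..t} g"
      using dg by (meson DERIV_isCont continuous_at_imp_continuous_on)
  qed
  have df: "(f has_real_derivative g t / (sinh t)\<^sup>2) (at t)" if "t > 0" for t
    unfolding f_def g_def using that by (auto intro!: derivative_eq_intros simp: power2_eq_square field_simps)
  have g0: "g 0 = -1" by (simp add: g_def)
  \<comment> \<open>For \<open>x \<ge> 2\<close>, \<open>sinh x \<ge> 2\<close> gives
    \<open>1 + (sinh x)^2 \<le> 5/4 * (sinh x)^2\<close>. Two such factors cost \<open>5/4\<close>,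
    which is less than \<open>n\<close>.\<close>
  have g2: "g 2 > 0"
  proof -
    define c :: real where "c = sqrt (5 / 4)"
    have c: "c \<ge> 0" "c * c = 5 / 4"
      unfolding c_def by (simp, simp only: real_sqrt_mult_self abs_of_nonneg)
    have cosh_le: "cosh x \<le> c * sinh x" if "x \<ge> 2" for x :: real
    proof -
      have "sinh x \<ge> 2" using real_le_x_sinh[of x] that by (simp add: sinh_def exp_minus)
      then have "(sinh x)\<^sup>2 \<ge> 2\<^sup>2" by (intro power_mono) auto
      then have "(cosh x)\<^sup>2 \<le> (c * c) * (sinh x)\<^sup>2"
        by (simp add: cosh_square_eq c)
      then have "(cosh x)\<^sup>2 \<le> (c * sinh x)\<^sup>2"
        by (simp only: power2_eq_square mult_ac)
      then show ?thesis by (rule power2_le_imp_le) (use that c in auto)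
    qed
    have pos: "sinh (real n * 2) * sinh 2 > 0" using n by simp
    have "cosh (real n * 2) * cosh 2 \<le> (c * sinh (real n * 2)) * (c * sinh 2)"
      using n c by (intro mult_mono cosh_le) auto
    also have "\<dots> = (c * c) * (sinh (real n * 2) * sinh 2)"
      by (simp only: mult_ac)
    also have "\<dots> < real n * (sinh (real n * 2) * sinh 2)"
      using n pos by (intro mult_strict_right_mono) (auto simp: c)
    finally show ?thesis by (simp add: g_def mult.assoc)
  qed
  obtain m where m: "0 \<le> m" "g m = 0"
    using IVT[of g 0 0 2] g0 g2 DERIV_isCont[OF dg] by auto
  have m0: "m > 0" using m g0 by (cases "m = 0") auto
  have contf: "continuous_on {s..t} f" if "s > 0" for s t
  proof (intro continuous_at_imp_continuous_on ballI)
    show "isCont f x" if "x \<in> {s..t}" for x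
      using DERIV_isCont[OF df[of x]] that \<open>s > 0\<close> by auto
  qed
  have dec: "f t < f s" if "0 < s" "s < t" "t \<le> m" for s t
  proof (rule DERIV_neg_imp_decreasing_open[OF that(2)])
    show "\<exists>y. (f has_real_derivative y) (at x) \<and> y < 0" if "s < x" "x < t" for x
      using df[of x] g_mono[of x m] m that \<open>0 < s\<close> \<open>t \<le> m\<close>
      by (intro exI[of _ "g x / (sinh x)\<^sup>2"]) (auto simp: divide_neg_pos)
    show "continuous_on {s..t} f"
      using contf that by blast
  qed
  have inc: "f s < f t" if "m \<le> s" "s < t" for s t
  proof (rule DERIV_pos_imp_increasing_open[OF that(2)])
    show "\<exists>y. (f has_real_derivative y) (at x) \<and> 0 < y" if "s < x" "x < t" for x
      using df[of x] g_mono[of m x] m m0 that \<open>m \<le> s\<close>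
      by (intro exI[of _ "g x / (sinh x)\<^sup>2"]) auto
    show "continuous_on {s..t} f"
      using contf that m0 by auto
  qed
  have fm: "f m < C"
    using C dec[of 1 m] inc[of m 1] by (cases "1::real" m rule: linorder_cases) (auto simp: f_def)
  have C0: "C > 0" using C by (auto intro: less_trans[rotated])
  have root_iff: "C * sinh t = cosh (real n * t) \<longleftrightarrow> f t = C" if "t > 0" for t
    using that by (auto simp: f_def field_simps)
  obtain a where a: "0 < a" "a < m" "f a > C"
  proof
    \<comment> \<open>Chosen so that \<open>C * sinh a \<le> 1/2\<close>, below the minimum 1 of
      \<open>cosh\<close>.\<close>
    define a where "a = min (m / 2) (arsinh (1 / (2 * C)))"
    show a: "0 < a" "a < m" using m0 C0 by (auto simp: a_def)
    have "sinh a \<le> sinh (arsinh (1 / (2 * C)))"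
      by (subst sinh_real_le_iff) (simp add: a_def)
    then have "C * sinh a \<le> 1 / 2" using C0 by (simp add: field_simps)
    also have "\<dots> < cosh (real n * a)" using cosh_real_ge_1[of "real n * a"] by linarith
    finally show "f a > C" using a by (simp add: f_def field_simps)
  qed
  obtain b where b: "f b > C" "m < b"
  proof
    \<comment> \<open>Then \<open>C \<le> b \<le> sinh b\<close>, so \<open>C * sinh b\<close> is at
      most \<open>(sinh b)^2\<close>, which is below \<open>cosh (2 * b)\<close>.\<close>
    define b where "b = m + C"
    have "b \<le> sinh b"
      using real_le_x_sinh[of b] m0 C0 by (simp add: sinh_def exp_minus) (simp add: b_def)
    have "C * sinh b \<le> b * sinh b"
      using m0 C0 by (intro mult_right_mono) (auto simp: b_def)
    also have "\<dots> \<le> sinh b * sinh b"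
      using m0 C0 \<open>b \<le> sinh b\<close> by (intro mult_right_mono) (auto simp: b_def)
    also have "\<dots> < cosh (2 * b)"
      by (simp add: cosh_double power2_eq_square add_pos_nonneg)
    also have "\<dots> \<le> cosh (real n * b)"
      using n m0 C0 by (subst cosh_real_nonneg_le_iff) (auto simp: b_def intro!: mult_right_mono simp del: distrib_left_numeral)
    finally show "f b > C" using m0 C0 by (simp add: f_def b_def field_simps)
    show "m < b" using C0 by (simp add: b_def)
  qed
  obtain x where x: "a \<le> x" "x \<le> m" "f x = C"
    using IVT2'[of f m C a] a fm contf[of a m] by auto
  obtain y where y: "m \<le> y" "y \<le> b" "f y = C"
    using IVT'[of f m C b] b fm contf[of m b] m0 by auto
  have "x < m" "m < y" using x y fm by (auto simp: le_less)
  have "{t. t > 0 \<and> C * sinh t = cosh (real n * t)} = {x, y}"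
  proof -
    have "t = x \<or> t = y" if "t > 0" "f t = C" for t
      using dec[of t x] dec[of x t] inc[of t y] inc[of y t] that a x y by (smt (verit))
    then show ?thesis using root_iff x y a m0 by auto
  qed
  then show "card {t. t > 0 \<and> C * sinh t = cosh (real n * t)} = 2"
    using \<open>x < m\<close> \<open>m < y\<close> by simp
  show "C * cosh t \<noteq> real n * sinh (real n * t)" if t: "t > 0" "C * sinh t = cosh (real n * t)" for t
  proof
    assume "C * cosh t = real n * sinh (real n * t)"
    \<comment> \<open>Substituting both equations into \<open>g t\<close> leaves
      \<open>C * cosh t * sinh t - C * sinh t * cosh t\<close>.\<close>
    then have "g t = 0"
      using t(2) by (simp add: g_def) (metis mult.assoc mult.commute)
    then have "t = m" using g_mono[of t m] g_mono[of m t] t m by (cases t m rule: linorder_cases) auto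
    then show False using fm root_iff t by auto
  qed
qed

section \<open>Chebyshev polynomials and the complex cosine on a strip\<close>

fun chebyshev :: "nat \<Rightarrow> complex poly" where
  "chebyshev 0 = 1"
| "chebyshev (Suc 0) = [:0, 1:]"
| "chebyshev (Suc (Suc n)) = [:0, 2:] * chebyshev (Suc n) - chebyshev n"

lemma degree_chebyshev: "degree (chebyshev n) = n"
proof (induction n rule: chebyshev.induct)
  case (3 n)
  have "degree ([:0, 2:] * chebyshev (Suc n)) = Suc (Suc n)"
  proof -
    have "chebyshev (Suc n) \<noteq> 0" using "3.IH"(1) by force
    then show ?thesis using "3.IH"(1) by (subst degree_mult_eq) auto
  qed
  then show ?case using "3.IH"(2) by (simp only: chebyshev.simps) (subst diff_conv_add_uminus, subst degree_add_eq_left, auto)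
qed auto

lemma poly_chebyshev_cos: "poly (chebyshev n) (cos w) = cos (of_nat n * w)"
proof (induction n rule: chebyshev.induct)
  case (3 n)
  have "cos (of_nat (Suc n) * w + w) + cos (of_nat (Suc n) * w - w) = 2 * cos w * cos (of_nat (Suc n) * w)"
    by (simp only: cos_add cos_diff) simp
  with 3 show ?case by (simp add: algebra_simps)
qed auto

text \<open>Obtained by differentiating \<open>T (cos w) = cos (n w)\<close>; keeping the factor
  \<open>sin w\<close> avoids a division.\<close>

lemma poly_pderiv_chebyshev_cos: "poly (pderiv (chebyshev n)) (cos w) * sin w = of_nat n * sin (of_nat n * w)"
proof -
  have "((\<lambda>w. poly (chebyshev n) (cos w)) has_field_derivative - (poly (pderiv (chebyshev n)) (cos w) * sin w)) (at w)"
    by (auto intro!: derivative_eq_intros DERIV_chain2[OF poly_DERIV])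
  moreover have "((\<lambda>w. cos (of_nat n * w)) has_field_derivative - (of_nat n * sin (of_nat n * w))) (at w)"
    by (auto intro!: derivative_eq_intros)
  ultimately show ?thesis using DERIV_unique by (fastforce simp: poly_chebyshev_cos)
qed

lemma Re_cos_cosh: "Re (cos w) = cos (Re w) * cosh (Im w)"
  by (simp add: Re_cos cosh_def)

lemma Im_cos_sinh: "Im (cos w) = - (sin (Re w) * sinh (Im w))"
  by (simp add: Im_cos sinh_def field_simps)

lemma Re_sin_cosh: "Re (sin w) = sin (Re w) * cosh (Im w)"
  by (simp add: Re_sin cosh_def)

lemma Im_sin_sinh: "Im (sin w) = cos (Re w) * sinh (Im w)"
  by (simp add: Im_sin sinh_def)

lemma complex_cos_surj_strip:
  obtains w where "0 \<le> Re w" "Re w \<le> pi" "cos w = z"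
proof (cases "Re (Arccos z) \<ge> 0")
  case True
  then show ?thesis using that[of "Arccos z"] Re_Arccos_bounds[of z] by auto
next
  \<comment> \<open>Cosine is even, so a value of \<open>Arccos\<close> with negative real part can
    be negated.\<close>
  case False
  then show ?thesis using that[of "- Arccos z"] Re_Arccos_bounds[of z] by auto
qed

lemma complex_cos_inj_strip: "inj_on cos {w::complex. 0 < Re w \<and> Re w < pi}"
proof (rule inj_onI, clarify)
  fix v w :: complex
  assume r: "0 < Re v" "Re v < pi" "0 < Re w" "Re w < pi" and "cos v = cos w"
  then obtain k :: int where k: "v = w + of_real (2 * k * pi) \<or> v = - w + of_real (2 * k * pi)"
    unfolding complex_cos_eq Ints_def by auto
  then have "Re v = Re w + 2 * k * pi \<or> Re v = - Re w + 2 * k * pi" by auto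
  then have "k = 0 \<and> v = w"
  proof
    assume *: "Re v = Re w + 2 * k * pi"
    then have "\<bar>2 * k * pi\<bar> < pi" using r by linarith
    then have "k = 0" by (simp add: abs_mult)
    then show ?thesis using * k r by auto
  next
    \<comment> \<open>Impossible: \<open>Re v + Re w\<close> lies strictly between 0 and
      \<open>2 * pi\<close>, where there is no multiple of \<open>2 * pi\<close>.\<close>
    assume *: "Re v = - Re w + 2 * k * pi"
    then have "0 < (2 * k) * pi" "(2 * k) * pi < 2 * pi" using r by linarith+
    then have "0 < 2 * real_of_int k" "2 * real_of_int k < 2" by (auto simp: zero_less_mult_iff)
    then have "0 < k" "k < 1" by linarith+
    then show ?thesis by linarith
  qed
  then show "v = w" by simp
qed

lemma cos_multiple_zeros:
  assumes "n > 0"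
  shows "card {a. 0 < a \<and> a < pi \<and> cos (real n * a) = 0} = n"
proof -
  have "{a. 0 < a \<and> a < pi \<and> cos (real n * a) = 0} = (\<lambda>k. (2 * real k + 1) * pi / (2 * real n)) ` {..<n}"
  proof (intro equalityI subsetI)
    fix a assume a: "a \<in> {a. 0 < a \<and> a < pi \<and> cos (real n * a) = 0}"
    then obtain i :: int where i: "odd i" "real n * a = i * (pi / 2)"
      unfolding mem_Collect_eq cos_zero_iff_int by auto
    have "0 < i * (pi / 2)" using a i(2) assms by (metis mem_Collect_eq of_nat_0_less_iff mult_pos_pos)
    then have "i > 0" by (simp add: zero_less_mult_iff)
    have "real n * a < real n * pi" using a assms by simp
    then have "i * pi < (2 * real n) * pi" using i(2) by simp
    then have "i < 2 * real n" by simp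
    then have "i < 2 * int n" by linarith
    obtain j where j: "i = 2 * j + 1" using i(1) by (elim oddE)
    have "j \<ge> 0" "j < int n" using \<open>i > 0\<close> \<open>i < 2 * int n\<close> j by auto
    then have "a = (\<lambda>k. (2 * real k + 1) * pi / (2 * real n)) (nat j)" "nat j \<in> {..<n}"
      using i(2) j assms by (auto simp: field_simps)
    then show "a \<in> (\<lambda>k. (2 * real k + 1) * pi / (2 * real n)) ` {..<n}" by blast
  next
    fix a assume "a \<in> (\<lambda>k. (2 * real k + 1) * pi / (2 * real n)) ` {..<n}"
    then obtain k where k: "k < n" "a = (2 * real k + 1) * pi / (2 * real n)" by auto
    have "real n * a = of_int (2 * int k + 1) * (pi / 2)" using k assms by (simp add: field_simps)
    then have "cos (real n * a) = 0" unfolding cos_zero_iff_int by (intro exI[of _ "2 * int k + 1"]) auto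
    moreover have "2 * real k + 1 < 2 * real n" using k by linarith
    then have "(2 * real k + 1) * pi < pi * (2 * real n)" by simp
    then have "a < pi" using k(2) assms by (simp add: pos_divide_less_eq del: distrib_right_numeral)
    ultimately show "a \<in> {a. 0 < a \<and> a < pi \<and> cos (real n * a) = 0}" using k assms by auto
  qed
  moreover have "inj_on (\<lambda>k. (2 * real k + 1) * pi / (2 * real n)) {..<n}"
    using assms by (auto simp: inj_on_def)
  ultimately show ?thesis by (simp add: card_image)
qed

lemma sin_multiple_zeros:
  assumes "n > 0"
  shows "card {a. 0 < a \<and> a < pi \<and> sin (real n * a) = 0} = n - 1"
proof -
  have "{a. 0 < a \<and> a < pi \<and> sin (real n * a) = 0} = (\<lambda>k. real k * pi / real n) ` {1..<n}"
  proof (intro equalityI subsetI)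
    fix a assume a: "a \<in> {a. 0 < a \<and> a < pi \<and> sin (real n * a) = 0}"
    then obtain i :: int where i: "real n * a = i * pi"
      unfolding mem_Collect_eq sin_zero_iff_int2 by auto
    have "0 < i * pi" using a i assms by (metis mem_Collect_eq of_nat_0_less_iff mult_pos_pos)
    then have "i > 0" by (simp add: zero_less_mult_iff)
    have "real n * a < real n * pi" using a assms by simp
    then have "i < real n" using i by simp
    then have "nat i \<in> {1..<n}" using \<open>i > 0\<close> by auto
    moreover have "a = real (nat i) * pi / real n"
      using i assms \<open>i > 0\<close> by (simp add: field_simps)
    ultimately show "a \<in> (\<lambda>k. real k * pi / real n) ` {1..<n}" by blast
  next
    fix a assume "a \<in> (\<lambda>k. real k * pi / real n) ` {1..<n}"
    then obtain k where k: "1 \<le> k" "k < n" "a = real k * pi / real n" by auto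
    then have "real n * a = real k * pi" by simp
    then have "sin (real n * a) = 0" by (simp only: sin_npi)
    moreover have "real k * pi < real n * pi" using k by simp
    then have "a < pi" using assms k by (simp add: pos_divide_less_eq mult.commute)
    ultimately show "a \<in> {a. 0 < a \<and> a < pi \<and> sin (real n * a) = 0}" using k assms by auto
  qed
  moreover have "inj_on (\<lambda>k. real k * pi / real n) {1..<n}"
    using assms by (auto simp: inj_on_def)
  ultimately show ?thesis by (simp add: card_image)
qed

section \<open>The harmonic polynomial and its zeros\<close>

text \<open>The factor \<open>\<i>\<close> turns \<open>cnj u = Q u\<close> into
  \<open>- 2 * Im u = e * T u\<close>, which forces \<open>T u\<close> to be real.\<close>

definition perturbed_line :: "nat \<Rightarrow> real \<Rightarrow> complex poly" where
  "perturbed_line n e = [:0, 1:] + smult (\<i> * of_real e) (chebyshev n)"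

lemma degree_perturbed_line:
  assumes "n > 1" "e \<noteq> 0"
  shows "degree (perturbed_line n e) = n"
  unfolding perturbed_line_def using assms
  by (subst degree_add_eq_right) (auto simp: degree_chebyshev)

text \<open>With \<open>u = cos w\<close> and \<open>T u = cos (n w)\<close>, these are the
  imaginary and real parts of \<open>- 2 * Im u = e * T u\<close>.\<close>

lemma perturbed_line_cos_iff:
  "cnj (cos w) = poly (perturbed_line n e) (cos w) \<longleftrightarrow>
     e * (sin (real n * Re w) * sinh (real n * Im w)) = 0 \<and>
     2 * sin (Re w) * sinh (Im w) = e * (cos (real n * Re w) * cosh (real n * Im w))"
proof -
  have "Re (of_nat n * w) = real n * Re w" "Im (of_nat n * w) = real n * Im w"
    by simp_all
  then show ?thesis
    unfolding perturbed_line_def complex_eq_iff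
    by (simp add: poly_chebyshev_cos Re_cos_cosh Im_cos_sinh del: Re_complex_of_real) auto
qed

lemma perturbed_line_zeros_eq:
  assumes n: "n > 0" and e: "e > 0"
  shows "{u. cnj u = poly (perturbed_line n e) u} =
     cos ` ((\<lambda>a. Complex a 0) ` {a. 0 < a \<and> a < pi \<and> cos (real n * a) = 0} \<union>
       (\<Union>a\<in>{a. 0 < a \<and> a < pi \<and> sin (real n * a) = 0}.
          Complex a ` {b. b \<noteq> 0 \<and> 2 * sin a * sinh b = e * (cos (real n * a) * cosh (real n * b))}))"
    (is "?L = cos ` (?A \<union> ?B)")
proof (intro equalityI subsetI)
  fix u assume u: "u \<in> ?L"
  obtain w where w: "0 \<le> Re w" "Re w \<le> pi" "cos w = u" by (rule complex_cos_surj_strip)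
  have eq: "sin (real n * Re w) * sinh (real n * Im w) = 0"
    "2 * sin (Re w) * sinh (Im w) = e * (cos (real n * Re w) * cosh (real n * Im w))"
    using u w e perturbed_line_cos_iff[of w n e] by auto
  \<comment> \<open>On the edges of the strip the left side of the second equation vanishes, while
    \<open>cos (n * Re w)\<close> is 1 or -1 there and \<open>cosh\<close> is positive.\<close>
  have "sin (Re w) \<noteq> 0"
  proof
    assume "sin (Re w) = 0"
    then have "Re w = 0 \<or> Re w = pi"
      using w sin_gt_zero[of "Re w"] by (auto simp: le_less)
    then have "cos (real n * Re w) \<noteq> 0" by auto
    then show False using eq(2) \<open>sin (Re w) = 0\<close> e by simp
  qed
  then have strip: "0 < Re w" "Re w < pi" using w by (auto simp: le_less)
  have "w \<in> ?A \<union> ?B"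
  proof (cases "Im w = 0")
    case True
    then have "w = Complex (Re w) 0" "cos (real n * Re w) = 0" using eq(2) e by (auto simp: complex_eq_iff)
    then show ?thesis using strip by blast
  next
    case False
    then have "sin (real n * Re w) = 0" using eq(1) n by simp
    moreover have "w = Complex (Re w) (Im w)" by simp
    ultimately show ?thesis using False strip eq(2) by blast
  qed
  then show "u \<in> cos ` (?A \<union> ?B)" using w by blast
next
  fix u assume "u \<in> cos ` (?A \<union> ?B)"
  then obtain w where w: "u = cos w" "w \<in> ?A \<union> ?B" by blast
  then have "cnj (cos w) = poly (perturbed_line n e) (cos w)"
    unfolding perturbed_line_cos_iff by auto
  then show "u \<in> ?L" using w by simp
qed

text \<open>Here \<open>s\<close> stands for \<open>sin a\<close> and \<open>c\<close> for
  \<open>cos (n a)\<close> on a hyperbola. Since \<open>sinh\<close> is odd and \<open>cosh\<close>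
  even, \<open>t = c * b\<close> absorbs the sign and leads to
  \<open>C * sinh t = cosh (n t)\<close> with \<open>C = 2 * s / e\<close>; positivity of
  \<open>cosh\<close> forces \<open>t > 0\<close>.\<close>

lemma scaled_sinh_cosh_roots:
  assumes n: "n > 1" and e: "e > 0" and c: "c = 1 \<or> c = -1"
    and small: "e * (cosh (real n) / sinh 1) < 2 * s"
  shows "card {b. b \<noteq> 0 \<and> 2 * s * sinh b = e * (c * cosh (real n * b))} = 2"
    and "\<And>b. b \<noteq> 0 \<Longrightarrow> 2 * s * sinh b = e * (c * cosh (real n * b)) \<Longrightarrow>
           2 * s * cosh b \<noteq> e * (c * (real n * sinh (real n * b)))"
proof -
  define C where "C = 2 * s / e"
  have C: "C > cosh (real n) / sinh 1"
    using small e by (simp add: C_def field_simps)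
  have s: "s > 0"
  proof -
    have "0 < e * (cosh (real n) / sinh 1)" using e by simp
    then show ?thesis using small by linarith
  qed
  have iff: "2 * s * sinh b = e * (c * cosh (real n * b)) \<longleftrightarrow> C * sinh (c * b) = cosh (real n * (c * b))" for b
    using c e by (auto simp: C_def field_simps)
  have iff': "2 * s * cosh b = e * (c * (real n * sinh (real n * b))) \<longleftrightarrow>
      C * cosh (c * b) = real n * sinh (real n * (c * b))" for b
    using c e by (auto simp: C_def field_simps)
  have pos: "c * b > 0" if "C * sinh (c * b) = cosh (real n * (c * b))" for b
  proof -
    have "C * sinh (c * b) > 0" using that by simp
    then show ?thesis using s e by (simp add: C_def zero_less_mult_iff zero_less_divide_iff)
  qed
  have "{b. b \<noteq> 0 \<and> 2 * s * sinh b = e * (c * cosh (real n * b))} =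
      (\<lambda>t. c * t) ` {t. t > 0 \<and> C * sinh t = cosh (real n * t)}"
  proof (intro equalityI subsetI)
    fix b assume "b \<in> {b. b \<noteq> 0 \<and> 2 * s * sinh b = e * (c * cosh (real n * b))}"
    then have "c * b \<in> {t. t > 0 \<and> C * sinh t = cosh (real n * t)}" using iff pos by auto
    moreover have "b = c * (c * b)" using c by auto
    ultimately show "b \<in> (\<lambda>t. c * t) ` {t. t > 0 \<and> C * sinh t = cosh (real n * t)}" by blast
  next
    fix b assume "b \<in> (\<lambda>t. c * t) ` {t. t > 0 \<and> C * sinh t = cosh (real n * t)}"
    then obtain t where t: "b = c * t" "t > 0" "C * sinh t = cosh (real n * t)" by blast
    then have "c * b = t" using c by auto
    then show "b \<in> {b. b \<noteq> 0 \<and> 2 * s * sinh b = e * (c * cosh (real n * b))}"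
      using t c iff[of b] by auto
  qed
  moreover have "inj_on (\<lambda>t. c * t) T" for T using c by (auto simp: inj_on_def)
  ultimately show "card {b. b \<noteq> 0 \<and> 2 * s * sinh b = e * (c * cosh (real n * b))} = 2"
    using two_sinh_cosh_roots(1)[OF n C] by (simp add: card_image)
  show "2 * s * cosh b \<noteq> e * (c * (real n * sinh (real n * b)))"
    if "b \<noteq> 0" "2 * s * sinh b = e * (c * cosh (real n * b))" for b
    using two_sinh_cosh_roots(2)[OF n C, of "c * b"] that pos[of b] iff[of b] iff'[of b] by auto
qed

lemma cos_eq_1_or_minus_1: "sin (x::real) = 0 \<Longrightarrow> cos x = 1 \<or> cos x = -1"
  using sin_cos_squared_add[of x] by (simp add: power2_eq_1_iff)

lemma sin_eq_1_or_minus_1: "cos (x::real) = 0 \<Longrightarrow> sin x = 1 \<or> sin x = -1"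
  using sin_cos_squared_add[of x] by (simp add: power2_eq_1_iff)

text \<open>There are \<open>n\<close> real zeros and two on each of \<open>n - 1\<close>
  hyperbolas. They are counted in the coordinate \<open>w\<close> and transported by
  \<open>cos\<close>, injective on the open strip.\<close>

lemma card_perturbed_line_zeros:
  assumes n: "n > 1" and e: "e > 0"
    and small: "\<And>a. 0 < a \<Longrightarrow> a < pi \<Longrightarrow> sin (real n * a) = 0 \<Longrightarrow>
                  e * (cosh (real n) / sinh 1) < 2 * sin a"
  shows "card {u. cnj u = poly (perturbed_line n e) u} = 3 * n - 2"
proof -
  define S where "S = {a. 0 < a \<and> a < pi \<and> sin (real n * a) = 0}"
  define A where "A = {a. 0 < a \<and> a < pi \<and> cos (real n * a) = 0}"
  define R where "R = (\<lambda>a. {b. b \<noteq> 0 \<and> 2 * sin a * sinh b = e * (cos (real n * a) * cosh (real n * b))})"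
  \<comment> \<open>Infinite sets have \<open>card\<close> 0, so a positive \<open>card\<close>
    yields finiteness.\<close>
  have S: "card S = n - 1" "finite S"
    using n sin_multiple_zeros[of n] card_ge_0_finite[of S] by (auto simp: S_def)
  have A: "card A = n" "finite A"
    using n cos_multiple_zeros[of n] card_ge_0_finite[of A] by (auto simp: A_def)
  have R: "card (R a) = 2" "finite (R a)" if "a \<in> S" for a
  proof -
    show "card (R a) = 2"
      unfolding R_def using that small[of a] cos_eq_1_or_minus_1[of "real n * a"] n e
      by (intro scaled_sinh_cosh_roots(1)) (auto simp: S_def)
    then show "finite (R a)" using card_ge_0_finite[of "R a"] by simp
  qed
  have "card (\<Union>a\<in>S. Complex a ` R a) = (\<Sum>a\<in>S. card (Complex a ` R a))"
    using S R by (intro card_UN_disjoint) auto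
  also have "\<dots> = (\<Sum>a\<in>S. 2)"
    using R by (intro sum.cong refl) (simp add: card_image inj_on_def)
  finally have B: "card (\<Union>a\<in>S. Complex a ` R a) = 2 * (n - 1)" using S by simp
  have A': "card ((\<lambda>a. Complex a 0) ` A) = n" using A by (simp add: card_image inj_on_def)
  have "card ((\<lambda>a. Complex a 0) ` A \<union> (\<Union>a\<in>S. Complex a ` R a)) = n + 2 * (n - 1)"
    using A S R A' B by (subst card_Un_disjoint) (auto simp: R_def)
  moreover have "inj_on cos ((\<lambda>a. Complex a 0) ` A \<union> (\<Union>a\<in>S. Complex a ` R a))"
    by (rule inj_on_subset[OF complex_cos_inj_strip]) (auto simp: A_def S_def)
  moreover have "{u. cnj u = poly (perturbed_line n e) u} =
      cos ` ((\<lambda>a. Complex a 0) ` A \<union> (\<Union>a\<in>S. Complex a ` R a))"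
    using n e by (subst perturbed_line_zeros_eq) (simp_all add: A_def S_def R_def)
  ultimately show ?thesis using n by (simp only: card_image)
qed

text \<open>Multiplied by \<open>sin w\<close>, a derivative of modulus 1 would make
  \<open>sin w + \<i> * e * n * sin (n w)\<close> and \<open>sin w\<close> equally long. At a real
  zero the added term is perpendicular and nonzero; on a hyperbola the equality would make
  \<open>Im w\<close> a double root.\<close>

lemma perturbed_line_zeros_nondegenerate:
  assumes n: "n > 1" and e: "e > 0"
    and small: "\<And>a. 0 < a \<Longrightarrow> a < pi \<Longrightarrow> sin (real n * a) = 0 \<Longrightarrow>
                  e * (cosh (real n) / sinh 1) < 2 * sin a"
    and u: "cnj u = poly (perturbed_line n e) u"
  shows "norm (poly (pderiv (perturbed_line n e)) u) \<noteq> 1"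
proof
  assume unit: "norm (poly (pderiv (perturbed_line n e)) u) = 1"
  obtain w where w: "u = cos w" "0 < Re w" "Re w < pi"
    "cos (real n * Re w) = 0 \<and> Im w = 0 \<or> sin (real n * Re w) = 0 \<and> Im w \<noteq> 0 \<and>
       2 * sin (Re w) * sinh (Im w) = e * (cos (real n * Re w) * cosh (real n * Im w))"
  proof -
    have "u \<in> {u. cnj u = poly (perturbed_line n e) u}" using u by simp
    then show ?thesis using that n e by (subst (asm) perturbed_line_zeros_eq) auto
  qed
  have s: "sin (Re w) > 0" using w sin_gt_zero by blast
  have "poly (pderiv (perturbed_line n e)) u * sin w =
      sin w + \<i> * of_real e * (of_nat n * sin (of_nat n * w))"
    using poly_pderiv_chebyshev_cos[of n w]
    by (simp add: perturbed_line_def pderiv_add pderiv_smult pderiv_pCons w algebra_simps)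
  then have "norm (sin w + \<i> * of_real e * (of_nat n * sin (of_nat n * w))) = norm (sin w)"
    using unit by (metis mult_1 norm_mult)
  then have "(norm (sin w + \<i> * of_real e * (of_nat n * sin (of_nat n * w))))\<^sup>2 = (norm (sin w))\<^sup>2"
    by simp
  moreover have "Re (of_nat n * w) = real n * Re w" "Im (of_nat n * w) = real n * Im w"
    by simp_all
  ultimately have norm_eq:
    "(sin (Re w) * cosh (Im w) - e * n * (cos (real n * Re w) * sinh (real n * Im w)))\<^sup>2 +
     (cos (Re w) * sinh (Im w) + e * n * (sin (real n * Re w) * cosh (real n * Im w)))\<^sup>2 =
     (sin (Re w) * cosh (Im w))\<^sup>2 + (cos (Re w) * sinh (Im w))\<^sup>2"
    unfolding cmod_power2 by (simp add: Re_sin_cosh Im_sin_sinh mult.assoc)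
  from w(4) show False
  proof
    assume "cos (real n * Re w) = 0 \<and> Im w = 0"
    then show False using norm_eq sin_eq_1_or_minus_1[of "real n * Re w"] n e by auto
  next
    assume *: "sin (real n * Re w) = 0 \<and> Im w \<noteq> 0 \<and>
       2 * sin (Re w) * sinh (Im w) = e * (cos (real n * Re w) * cosh (real n * Im w))"
    define c where "c = cos (real n * Re w)"
    have c: "c = 1 \<or> c = -1" using * cos_eq_1_or_minus_1 c_def by blast
    define d where "d = e * n * (c * sinh (real n * Im w))"
    have "d \<noteq> 0" using * c e n by (auto simp: d_def)
    \<comment> \<open>The squares in \<open>norm_eq\<close> cancel up to the cross term; division by
      \<open>d\<close> then gives the derivative of the hyperbola equation, which fails at a simple
      root.\<close>
    have "d * d = d * (2 * (sin (Re w) * cosh (Im w)))"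
      using norm_eq * by (simp add: d_def c_def power2_eq_square algebra_simps)
    then have "2 * sin (Re w) * cosh (Im w) = d" using \<open>d \<noteq> 0\<close> by simp
    moreover have "2 * sin (Re w) * cosh (Im w) \<noteq> e * (c * (real n * sinh (real n * Im w)))"
      using * small[of "Re w"] w c n e by (intro scaled_sinh_cosh_roots(2)) (auto simp: c_def)
    ultimately show False by (simp add: d_def mult_ac)
  qed
qed

text \<open>Only finitely many \<open>a\<close> occur, each with \<open>sin a > 0\<close>, so one
  \<open>e\<close> serves all hyperbolas.\<close>

lemma small_parameter_exists:
  assumes n: "n > 1"
  shows "\<exists>e>0. \<forall>a. 0 < a \<and> a < pi \<and> sin (real n * a) = 0 \<longrightarrow>
           e * (cosh (real n) / sinh 1) < 2 * sin a"
proof -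
  define S where "S = {a. 0 < a \<and> a < pi \<and> sin (real n * a) = 0}"
  have S: "finite S"
    using n sin_multiple_zeros[of n] card_ge_0_finite[of S] by (simp add: S_def)
  have "\<forall>\<^sub>F e in at_right 0. \<forall>a\<in>S. e * (cosh (real n) / sinh 1) < 2 * sin a"
  proof (intro eventually_ball_finite S ballI)
    fix a assume "a \<in> S"
    then have "0 < 2 * sin a" by (auto simp: S_def sin_gt_zero)
    moreover have "((\<lambda>e. e * (cosh (real n) / sinh 1)) \<longlongrightarrow> 0 * (cosh (real n) / sinh 1)) (at_right 0)"
      by (intro tendsto_intros)
    ultimately show "\<forall>\<^sub>F e in at_right 0. e * (cosh (real n) / sinh 1) < 2 * sin a"
      by (intro order_tendstoD(2)) auto
  qed
  moreover have "\<forall>\<^sub>F e in at_right (0::real). e > 0" by (simp add: eventually_at_right_less)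
  ultimately have "\<forall>\<^sub>F e in at_right 0. e > 0 \<and> (\<forall>a\<in>S. e * (cosh (real n) / sinh 1) < 2 * sin a)"
    by eventually_elim auto
  then obtain e where "e > 0 \<and> (\<forall>a\<in>S. e * (cosh (real n) / sinh 1) < 2 * sin a)"
    using eventually_happens'[OF trivial_limit_at_right_real] by blast
  then show ?thesis unfolding S_def by blast
qed

section \<open>From the perturbed equation to \<open>p\<close> and \<open>q\<close>\<close>

theorem theorem1p3:
  fixes n :: nat
  assumes "n > 1"
  shows "\<exists>(p :: complex poly) (q :: complex poly) (w :: complex).
           degree p = n \<and> degree q = 1 \<and>
           card {z :: complex. poly p z * cnj (poly q z) = w} = 3 * n - 1"
proof -
  obtain e where e: "e > 0" and small: "\<And>a. 0 < a \<Longrightarrow> a < pi \<Longrightarrow> sin (real n * a) = 0 \<Longrightarrow>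
      e * (cosh (real n) / sinh 1) < 2 * sin a"
    using small_parameter_exists[OF assms] by blast
  define Q where "Q = perturbed_line n e"
  have deg: "degree Q = n"
    unfolding Q_def using assms e by (intro degree_perturbed_line) auto
  have card: "card {u. cnj u = poly Q u} = 3 * n - 2"
    unfolding Q_def using assms e small by (rule card_perturbed_line_zeros)
  have fin: "finite {u. cnj u = poly Q u}"
    using card assms by (intro card_ge_0_finite) simp
  have nd: "norm (poly (pderiv Q) u) \<noteq> 1" if "u \<in> {u. cnj u = poly Q u}" for u
  proof -
    have "cnj u = poly (perturbed_line n e) u" using that by (simp only: Q_def mem_Collect_eq)
    with assms e small show ?thesis unfolding Q_def by (rule perturbed_line_zeros_nondegenerate)
  qed
  have "\<forall>\<^sub>F d in at_right 0.
      card {u. (cnj u - poly Q u) + of_real d * - (cnj u * poly Q u) = 0} = 3 * n - 2 + 1"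
    using card_perturbed_zeros[OF _ fin nd] deg assms card by simp
  moreover have "\<forall>\<^sub>F d in at_right (0::real). d > 0" by (simp add: eventually_at_right_less)
  ultimately have "\<forall>\<^sub>F d in at_right 0. d > 0 \<and>
      card {u. (cnj u - poly Q u) + of_real d * - (cnj u * poly Q u) = 0} = 3 * n - 2 + 1"
    by eventually_elim simp
  then obtain d :: real where d: "d > 0"
    "card {u. (cnj u - poly Q u) + of_real d * - (cnj u * poly Q u) = 0} = 3 * n - 2 + 1"
    using eventually_happens'[OF trivial_limit_at_right_real] by blast
  \<comment> \<open>As \<open>d\<close> is real, \<open>cnj (q u) = 1 + d * cnj u\<close>; expanding
    \<open>p u * cnj (q u) - 1\<close> gives \<open>d\<close> times the perturbed equation, and
    \<open>d > 0\<close> can be cancelled.\<close>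
  define p where "p = 1 - smult (of_real d) Q"
  define q :: "complex poly" where "q = [:1, of_real d:]"
  have "poly p u * cnj (poly q u) = 1 \<longleftrightarrow> (cnj u - poly Q u) + of_real d * - (cnj u * poly Q u) = 0" for u
  proof -
    have "poly p u * cnj (poly q u) - 1 =
        of_real d * ((cnj u - poly Q u) + of_real d * - (cnj u * poly Q u))"
      by (simp add: p_def q_def algebra_simps)
    then show ?thesis using d(1) by (metis eq_iff_diff_eq_0 mult_eq_0_iff of_real_eq_0_iff less_irrefl)
  qed
  then have "card {z. poly p z * cnj (poly q z) = 1} = 3 * n - 1"
    using d(2) assms by simp
  moreover have "degree p = n"
  proof -
    have "degree (1 :: complex poly) < degree (- smult (of_real d) Q)" using d(1) deg assms by simp
    then have "degree (1 + - smult (of_real d) Q) = degree (- smult (of_real d) Q)"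
      by (rule degree_add_eq_right)
    then show ?thesis using d(1) deg by (simp add: p_def)
  qed
  moreover have "degree q = 1" using d(1) by (simp add: q_def)
  ultimately show ?thesis by blast
qed

end
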